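(* Suppose that for some positive integer $t$, the positive integers $n,r,c$ satisfy $$n=\frac12(t^2-2)(t^2-1)\quad\text{and}\quad rc=\frac12(t-1)^3(t+2),$$ and $r\geq 4$ is an even integer. Then $(n,r,c)$ satisfies all the feasibility conditions for an abelian drackn (conditions (a)–(j) listed in the context) if and only if all of the following hold. (1) $t\ge3$ and $t$ is not divisible by four. (2) $c\ge2$. (3) If $r\le\frac12(t^2+1)$, then $r$ divides $t-1$. (4) If $t$ is odd, then $c$ is even. (5) Any odd prime that divides $r$ must divide $t-1$ as well.
   Context: For integers $n\ge2$, $r\ge2$, $c\ge1$ put $\delta=n-rc-2$, $\theta=\frac{\delta+\sqrt{\delta^2+4(n-1)}}{2}$, $\tau=\frac{\delta-\sqrt{\delta^2+4(n-1)}}{2}$, $m_\theta=\frac{n(r-1)\tau}{\tau-\theta}$, $m_\tau=\frac{n(r-1)\theta}{\theta-\tau}$. The feasibility conditions (which are necessary conditions for the existence of an abelian distance-regular antipodal $r$-fold cover of $K_n$ of diameter 3 in which vertices at distance two have $c$ common neighbours, called an abelian $(n,r,c)$-drackn) are: $n\ge2$, $r\ge2$, $c\ge1$, and (a) $1\le c(r-1)\le n-2\le c(2r-1)-2$. (b) $m_\theta$ and $m_\tau$ are integers. (c) If $\delta\ne0$, then $\theta$ and $\tau$ are integers. (d) If $\delta=0$, then $\theta=-\tau=\sqrt{n-1}$. (e) If $n$ is even, then $c$ is even. (f) If $c=1$, then $(n-r)$ divides $n-1$, $(n-r)(n-r+1)$ divides $rn(n-1)$, and $(n-r)^2\le n-1$.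 (g) If $r>2$, then $\theta^3\ge n-1$. (h) Suppose $\theta\ne1$, $\tau\ne-1$ and $\theta^3\ne n-1$. If $r>2$, then $rn\le\frac12m_\theta(m_\theta+1)$ and $rn\le\frac12m_\tau(m_\tau+1)$. If $r=2$, then $n\le\frac12m_\theta(m_\theta+1)$ and $n\le\frac12m_\tau(m_\tau+1)$. (i) If $r>2$, $\beta\in\{\theta,\tau\}$ is an integer, and $n>m_\beta-r+3$, then $\beta+1$ divides $c$. (j) Any odd prime that divides $r$ also divides $n$. *)

theory Defs
  imports Complex_Main "HOL-Computational_Algebra.Primes"
begin

(* Parameters of a putative antipodal distance-regular r-fold cover of K_n of diameter 3 (a
   "drackn"), where c counts the common neighbours of two vertices at distance two.  Besides
   n - 1 and -1, its eigenvalues are theta and tau, with multiplicities m_theta and m_tau. *)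
definition drackn_delta :: "int \<Rightarrow> int \<Rightarrow> int \<Rightarrow> int" where
  "drackn_delta n r c = n - r * c - 2"

definition drackn_theta :: "int \<Rightarrow> int \<Rightarrow> int \<Rightarrow> real" where
  "drackn_theta n r c =
     (real_of_int (drackn_delta n r c)
       + sqrt ((real_of_int (drackn_delta n r c))\<^sup>2 + 4 * (real_of_int n - 1))) / 2"

definition drackn_tau :: "int \<Rightarrow> int \<Rightarrow> int \<Rightarrow> real" where
  "drackn_tau n r c =
     (real_of_int (drackn_delta n r c)
       - sqrt ((real_of_int (drackn_delta n r c))\<^sup>2 + 4 * (real_of_int n - 1))) / 2"

definition drackn_m_theta :: "int \<Rightarrow> int \<Rightarrow> int \<Rightarrow> real" where
  "drackn_m_theta n r c =
     real_of_int n * (real_of_int r - 1) * drackn_tau n r c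
       / (drackn_tau n r c - drackn_theta n r c)"

definition drackn_m_tau :: "int \<Rightarrow> int \<Rightarrow> int \<Rightarrow> real" where
  "drackn_m_tau n r c =
     real_of_int n * (real_of_int r - 1) * drackn_theta n r c
       / (drackn_theta n r c - drackn_tau n r c)"

definition drackn_cond_a :: "int \<Rightarrow> int \<Rightarrow> int \<Rightarrow> bool" where
  "drackn_cond_a n r c \<longleftrightarrow>
     1 \<le> c * (r - 1) \<and> c * (r - 1) \<le> n - 2 \<and> n - 2 \<le> c * (2 * r - 1) - 2"

definition drackn_cond_b :: "int \<Rightarrow> int \<Rightarrow> int \<Rightarrow> bool" where
  "drackn_cond_b n r c \<longleftrightarrow> drackn_m_theta n r c \<in> \<int> \<and> drackn_m_tau n r c \<in> \<int>"

definition drackn_cond_c :: "int \<Rightarrow> int \<Rightarrow> int \<Rightarrow> bool" where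
  "drackn_cond_c n r c \<longleftrightarrow>
     (drackn_delta n r c \<noteq> 0 \<longrightarrow> drackn_theta n r c \<in> \<int> \<and> drackn_tau n r c \<in> \<int>)"

definition drackn_cond_d :: "int \<Rightarrow> int \<Rightarrow> int \<Rightarrow> bool" where
  "drackn_cond_d n r c \<longleftrightarrow>
     (drackn_delta n r c = 0 \<longrightarrow>
        drackn_theta n r c = - drackn_tau n r c \<and>
        - drackn_tau n r c = sqrt (real_of_int n - 1))"

definition drackn_cond_e :: "int \<Rightarrow> int \<Rightarrow> int \<Rightarrow> bool" where
  "drackn_cond_e n r c \<longleftrightarrow> (even n \<longrightarrow> even c)"

definition drackn_cond_f :: "int \<Rightarrow> int \<Rightarrow> int \<Rightarrow> bool" where
  "drackn_cond_f n r c \<longleftrightarrow>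
     (c = 1 \<longrightarrow>
        (n - r) dvd (n - 1) \<and>
        (n - r) * (n - r + 1) dvd r * n * (n - 1) \<and>
        (n - r)\<^sup>2 \<le> n - 1)"

definition drackn_cond_g :: "int \<Rightarrow> int \<Rightarrow> int \<Rightarrow> bool" where
  "drackn_cond_g n r c \<longleftrightarrow> (r > 2 \<longrightarrow> drackn_theta n r c ^ 3 \<ge> real_of_int n - 1)"

definition drackn_cond_h :: "int \<Rightarrow> int \<Rightarrow> int \<Rightarrow> bool" where
  "drackn_cond_h n r c \<longleftrightarrow>
     (drackn_theta n r c \<noteq> 1 \<and> drackn_tau n r c \<noteq> -1 \<and>
      drackn_theta n r c ^ 3 \<noteq> real_of_int n - 1 \<longrightarrow>
        (r > 2 \<longrightarrow>
           real_of_int (r * n) \<le> 1 / 2 * drackn_m_theta n r c * (drackn_m_theta n r c + 1) \<and>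
           real_of_int (r * n) \<le> 1 / 2 * drackn_m_tau n r c * (drackn_m_tau n r c + 1)) \<and>
        (r = 2 \<longrightarrow>
           real_of_int n \<le> 1 / 2 * drackn_m_theta n r c * (drackn_m_theta n r c + 1) \<and>
           real_of_int n \<le> 1 / 2 * drackn_m_tau n r c * (drackn_m_tau n r c + 1)))"

(* The integer b is the eigenvalue beta itself, so that "b + 1 dvd c" is divisibility in the
   integers; over the reals "dvd" would be trivial. *)
definition drackn_cond_i :: "int \<Rightarrow> int \<Rightarrow> int \<Rightarrow> bool" where
  "drackn_cond_i n r c \<longleftrightarrow>
     (r > 2 \<longrightarrow>
        (\<forall>b :: int. real_of_int b = drackn_theta n r c \<and>
            real_of_int n > drackn_m_theta n r c - real_of_int r + 3 \<longrightarrow> b + 1 dvd c) \<and>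
        (\<forall>b :: int. real_of_int b = drackn_tau n r c \<and>
            real_of_int n > drackn_m_tau n r c - real_of_int r + 3 \<longrightarrow> b + 1 dvd c))"

definition drackn_cond_j :: "int \<Rightarrow> int \<Rightarrow> int \<Rightarrow> bool" where
  "drackn_cond_j n r c \<longleftrightarrow> (\<forall>p :: int. prime p \<and> odd p \<and> p dvd r \<longrightarrow> p dvd n)"

definition abelian_drackn_feasible :: "int \<Rightarrow> int \<Rightarrow> int \<Rightarrow> bool" where
  "abelian_drackn_feasible n r c \<longleftrightarrow>
     n \<ge> 2 \<and> r \<ge> 2 \<and> c \<ge> 1 \<and>
     drackn_cond_a n r c \<and> drackn_cond_b n r c \<and> drackn_cond_c n r c \<and>
     drackn_cond_d n r c \<and> drackn_cond_e n r c \<and> drackn_cond_f n r c \<and>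
     drackn_cond_g n r c \<and> drackn_cond_h n r c \<and> drackn_cond_i n r c \<and>
     drackn_cond_j n r c"

end

theory Submission
  imports Defs
begin

text \<open>
  The eigenvalues are \<open>\<theta> = t (t\<^sup>2 - 3) / 2\<close> and \<open>\<tau> = - t\<close>, so that
  \<open>m\<^sub>\<theta> = (t\<^sup>2 - 2) (r - 1)\<close>, and \<open>m\<^sub>\<tau> = n (r - 1) - m\<^sub>\<theta>\<close>.  Positivity of \<open>r c\<close> and \<open>r \<ge> 4\<close>
  force \<open>t \<ge> 3\<close>, and \<open>4\<close> cannot divide \<open>t\<close>, as \<open>r c\<close> would then be odd.  Conditions (a)--(d), (g)
  and (h) now hold automatically; (e), (f), (j) become (4), (2), (5), and (i) becomes (3) because
  its hypothesis fails for \<open>\<tau>\<close>, amounts to \<open>r \<le> (t\<^sup>2 + 1) / 2\<close> for \<open>\<theta>\<close>, and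
  \<open>r c = (t - 1) (\<theta> + 1)\<close>.
\<close>

text \<open>The eigenvalues are the roots of \<open>x\<^sup>2 - delta * x - (n - 1)\<close>. The
  numbers \<open>h\<close> and \<open>- t\<close> have the right sum and product, and
  \<open>h + t \<ge> 0\<close> makes \<open>h\<close> the larger root.\<close>

lemma drackn_eigenvalues:
  fixes n r c h t :: int
  assumes "drackn_delta n r c = h - t" and "n = h * t + 1" and "h + t \<ge> 0"
  shows "drackn_theta n r c = of_int h" and "drackn_tau n r c = - of_int t"
proof -
  have "(real_of_int h - of_int t)\<^sup>2 + 4 * (of_int n - 1) = (of_int (h + t))\<^sup>2"
    unfolding assms(2) by (simp add: power2_eq_square algebra_simps)
  moreover have "sqrt ((real_of_int (h + t))\<^sup>2) = of_int (h + t)"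
    using assms(3) by (metis of_int_0_le_iff real_sqrt_abs abs_of_nonneg)
  ultimately have "sqrt ((real_of_int (h - t))\<^sup>2 + 4 * (of_int n - 1)) = of_int (h + t)"
    by simp
  then show "drackn_theta n r c = of_int h" "drackn_tau n r c = - of_int t"
    unfolding drackn_theta_def drackn_tau_def assms(1) by simp_all
qed

text \<open>The parameter \<open>h\<close> is the future value of theta. The equations are doubled
  so that everything stays in the integers.\<close>

locale drackn_family =
  fixes t n r c h :: int
  assumes t_pos: "t > 0" and c_pos: "c > 0" and r_ge: "r \<ge> 4" and r_even: "even r"
    and n_eq: "2 * n = (t\<^sup>2 - 2) * (t\<^sup>2 - 1)"
    and rc_eq: "2 * (r * c) = (t - 1) ^ 3 * (t + 2)"
    and h_eq: "2 * h = t * (t\<^sup>2 - 3)"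
begin

section \<open>Size of the parameters and the eigenvalues\<close>

lemma t_ge: "t \<ge> 3"
proof (rule ccontr)
  assume "\<not> t \<ge> 3"
  with t_pos have "t = 1 \<or> t = 2" by auto
  \<comment> \<open>The right-hand side of \<open>rc_eq\<close> is 0 or 4 here, whereas
    \<open>r * c \<ge> r \<ge> 4\<close>.\<close>
  then have "2 * (r * c) \<le> 4" unfolding rc_eq by auto
  moreover have "r * 1 \<le> r * c" using r_ge c_pos by (intro mult_left_mono) auto
  ultimately show False using r_ge by linarith
qed

lemma t2_ge: "t\<^sup>2 \<ge> 9"
  using power_mono[OF t_ge, of 2] by simp

lemma h_ge: "h \<ge> 3 * t"
proof -
  have "t * 6 \<le> t * (t\<^sup>2 - 3)" using t2_ge t_pos by (intro mult_left_mono) auto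
  then show ?thesis using h_eq by linarith
qed

lemma n_eq_mult: "n = h * t + 1"
proof -
  have "2 * n = 2 * h * t + 2"
    unfolding n_eq h_eq by (simp add: algebra_simps power2_eq_square)
  then show ?thesis by simp
qed

text \<open>Rests on \<open>2 * h + 2 = (t - 1)\<^sup>2 * (t + 2)\<close>, which leaves one factor
  \<open>t - 1\<close> over.\<close>

lemma rc_eq_mult: "r * c = (t - 1) * (h + 1)"
proof -
  have "2 * (r * c) = (t - 1) * (2 * h + 2)"
    unfolding rc_eq h_eq by (simp add: algebra_simps power2_eq_square power3_eq_cube)
  then show ?thesis by (simp add: algebra_simps)
qed

lemma delta_eq: "drackn_delta n r c = h - t"
  unfolding drackn_delta_def rc_eq_mult n_eq_mult by (simp add: algebra_simps)

lemma theta_eq: "drackn_theta n r c = of_int h"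
  and tau_eq: "drackn_tau n r c = - of_int t"
  using drackn_eigenvalues[OF delta_eq n_eq_mult] h_ge t_pos by auto

section \<open>Multiplicities\<close>

lemma n_mult_t: "n * t = (t\<^sup>2 - 2) * (h + t)"
proof -
  have "2 * (n * t) = 2 * n * t" by simp
  also have "\<dots> = (t\<^sup>2 - 2) * (2 * h + 2 * t)"
    unfolding n_eq h_eq by (simp add: algebra_simps power2_eq_square)
  finally show ?thesis by (simp add: algebra_simps)
qed

text \<open>The denominator is theta - tau = \<open>h + t\<close> up to sign, and
  \<open>n_mult_t\<close> cancels it.\<close>

lemma m_theta_eq: "drackn_m_theta n r c = of_int ((t\<^sup>2 - 2) * (r - 1))"
proof -
  have "real_of_int h + of_int t > 0" using h_ge t_pos by linarith
  moreover have "real_of_int n * of_int t = of_int (t\<^sup>2 - 2) * (of_int h + of_int t)"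
    using n_mult_t by (metis of_int_mult of_int_add)
  ultimately show ?thesis
    unfolding drackn_m_theta_def theta_eq tau_eq by (simp add: divide_simps) algebra
qed

text \<open>The two multiplicities add up to \<open>n * (r - 1)\<close>.\<close>

lemma m_tau_eq: "drackn_m_tau n r c = of_int ((n - (t\<^sup>2 - 2)) * (r - 1))"
proof -
  have "real_of_int h + of_int t > 0" using h_ge t_pos by linarith
  moreover have "real_of_int n * of_int h = of_int (n - (t\<^sup>2 - 2)) * (of_int h + of_int t)"
  proof -
    have "n * h = (n - (t\<^sup>2 - 2)) * (h + t)"
      using n_mult_t by (simp add: algebra_simps)
    then show ?thesis by (metis of_int_mult of_int_add)
  qed
  ultimately show ?thesis
    unfolding drackn_m_tau_def theta_eq tau_eq by (simp add: divide_simps)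
qed

lemma n_ge: "4 * (t\<^sup>2 - 2) \<le> n"
proof -
  have "(t\<^sup>2 - 2) * 8 \<le> (t\<^sup>2 - 2) * (t\<^sup>2 - 1)"
    using t2_ge by (intro mult_left_mono) auto
  then have "(t\<^sup>2 - 2) * 8 \<le> 2 * n" unfolding n_eq .
  then show ?thesis by simp
qed

lemma m_tau_ge: "3 * (t\<^sup>2 - 2) * (r - 1) \<le> (n - (t\<^sup>2 - 2)) * (r - 1)"
proof (rule mult_right_mono)
  show "3 * (t\<^sup>2 - 2) \<le> n - (t\<^sup>2 - 2)" using n_ge by simp
qed (use r_ge in simp)

lemma not_4_dvd_t: "\<not> 4 dvd t"
proof
  assume "4 dvd t"
  then obtain k where k: "t = 4 * k" by (elim dvdE)
  then have "t + 2 = 2 * (2 * k + 1)" by simp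
  then have "2 * (r * c) = 2 * ((t - 1) ^ 3 * (2 * k + 1))"
    using rc_eq by (simp only: mult_ac)
  then have "r * c = (t - 1) ^ 3 * (2 * k + 1)" by simp
  then have "odd (r * c)" using k by simp
  with r_even show False by simp
qed

section \<open>Conditions (a) to (f)\<close>

lemma cond_a: "drackn_cond_a n r c"
proof -
  have "1 * 3 \<le> c * (r - 1)" using c_pos r_ge by (intro mult_mono) auto
  moreover have "c * (r - 1) \<le> n - 2"
    using delta_eq h_ge t_pos c_pos unfolding drackn_delta_def by (simp add: algebra_simps)
  moreover have "n - 2 \<le> c * (2 * r - 1) - 2"
  proof -
    have "4 * c \<le> r * c" using r_ge c_pos by (intro mult_right_mono) auto
    \<comment> \<open>The goal is \<open>n \<le> 2 * r * c - c\<close>, and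
      \<open>4 * c \<le> r * c\<close> makes its right-hand side at least 7/4 of
      \<open>r * c\<close>.\<close>
    moreover have "4 * n \<le> 7 * (r * c)"
    proof -
      have "3 * h \<le> t * h" using t_ge h_ge by (intro mult_right_mono) auto
      moreover have "7 * (r * c) - 4 * n = 3 * (t * h) - 7 * h + 7 * t - 11"
        unfolding rc_eq_mult n_eq_mult by (simp add: algebra_simps)
      ultimately show ?thesis using h_ge t_ge by linarith
    qed
    ultimately show ?thesis by (simp add: algebra_simps)
  qed
  ultimately show ?thesis unfolding drackn_cond_a_def by simp
qed

lemma cond_b: "drackn_cond_b n r c"
  unfolding drackn_cond_b_def m_theta_eq m_tau_eq by simp

lemma cond_c: "drackn_cond_c n r c"
  unfolding drackn_cond_c_def theta_eq tau_eq by simp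

lemma cond_d: "drackn_cond_d n r c"
  unfolding drackn_cond_d_def delta_eq using h_ge t_pos by simp

text \<open>For odd \<open>t\<close>, 4 divides \<open>t\<^sup>2 - 1\<close>; for even
  \<open>t\<close>, \<open>n = h * t + 1\<close> is odd.\<close>

lemma even_n_iff: "even n \<longleftrightarrow> odd t"
proof
  assume "odd t"
  then obtain k where k: "t = 2 * k + 1" by (elim oddE)
  have "n = 2 * ((t\<^sup>2 - 2) * (k\<^sup>2 + k))"
    using n_eq unfolding k by (simp add: algebra_simps power2_eq_square)
  then show "even n" by simp
next
  show "odd t" if "even n"
    using that n_eq_mult by auto
qed

lemma cond_e_iff: "drackn_cond_e n r c \<longleftrightarrow> (odd t \<longrightarrow> even c)"
  unfolding drackn_cond_e_def even_n_iff ..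

text \<open>If \<open>c = 1\<close>, the last clause of (f) fails: \<open>n - r\<close> is too large
  for its square to be at most \<open>n - 1\<close>.\<close>

lemma cond_f_iff: "drackn_cond_f n r c \<longleftrightarrow> c \<ge> 2"
proof
  assume f: "drackn_cond_f n r c"
  have "c \<noteq> 1"
  proof
    assume c: "c = 1"
    define x where "x = h - t + 2"
    from c delta_eq have "n - r = x" unfolding drackn_delta_def x_def by simp
    with f c have "x * x \<le> h * t"
      unfolding drackn_cond_f_def n_eq_mult by (simp add: power2_eq_square)
    \<comment> \<open>From \<open>h \<ge> 3 * t\<close> follow \<open>h \<le> 2 * x\<close> and
      \<open>2 * t + 2 \<le> x\<close>; the product contradicts
      \<open>x * x \<le> h * t\<close>.\<close>
    moreover have "h * (2 * t + 2) \<le> (2 * x) * x"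
      using h_ge t_pos unfolding x_def by (intro mult_mono) auto
    ultimately show False using h_ge t_pos by (simp add: algebra_simps)
  qed
  with c_pos show "c \<ge> 2" by simp
qed (simp add: drackn_cond_f_def)

section \<open>Conditions (g) and (h)\<close>

lemma theta_cube: "drackn_theta n r c ^ 3 > of_int n - 1"
proof -
  have "h * t < h * h\<^sup>2"
  proof (rule mult_strict_left_mono)
    show "0 < h" using h_ge t_pos by linarith
    then have "1 * h \<le> h * h" by (intro mult_right_mono) auto
    then show "t < h\<^sup>2" using h_ge t_pos unfolding power2_eq_square by linarith
  qed
  then have "n - 1 < h ^ 3" unfolding n_eq_mult by (simp add: power2_eq_square power3_eq_cube)
  then have "real_of_int (n - 1) < of_int (h ^ 3)" unfolding of_int_less_iff .
  then show ?thesis unfolding theta_eq by simp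
qed

lemma cond_g: "drackn_cond_g n r c"
  unfolding drackn_cond_g_def using theta_cube by simp

text \<open>Both sides contain the factor \<open>t\<^sup>2 - 2\<close>. Without it, the left is
  linear in \<open>r\<close> and the right quadratic, and \<open>(r - 1)\<^sup>2 \<ge> r + 1\<close>
  suffices.\<close>

lemma rn_le_m_theta: "2 * (r * n) \<le> ((t\<^sup>2 - 2) * (r - 1)) * ((t\<^sup>2 - 2) * (r - 1) + 1)"
proof -
  have "(t\<^sup>2 - 2) * (r * (t\<^sup>2 - 1)) \<le> (t\<^sup>2 - 2) * ((r - 1) * ((t\<^sup>2 - 2) * (r - 1) + 1))"
  proof (rule mult_left_mono)
    have "3 * (r - 1) \<le> (r - 1) * (r - 1)" using r_ge by (intro mult_right_mono) auto
    then have "(t\<^sup>2 - 2) * (r + 1) \<le> (t\<^sup>2 - 2) * ((r - 1) * (r - 1))"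
      using t2_ge r_ge by (intro mult_left_mono) auto
    then show "r * (t\<^sup>2 - 1) \<le> (r - 1) * ((t\<^sup>2 - 2) * (r - 1) + 1)"
      using t2_ge by (simp add: algebra_simps)
  qed (use t2_ge in simp)
  moreover have "2 * (r * n) = (t\<^sup>2 - 2) * (r * (t\<^sup>2 - 1))"
  proof -
    have "2 * (r * n) = r * (2 * n)" by simp
    then show ?thesis unfolding n_eq by (simp only: mult_ac)
  qed
  ultimately show ?thesis by (simp only: mult.assoc)
qed

text \<open>Follows from the bound for theta, since \<open>a * (a + 1)\<close> is monotone on
  nonnegative integers and the multiplicity of tau is the larger one.\<close>

lemma rn_le_m_tau:
  "2 * (r * n) \<le> ((n - (t\<^sup>2 - 2)) * (r - 1)) * ((n - (t\<^sup>2 - 2)) * (r - 1) + 1)"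
proof -
  have "a * (a + 1) \<le> b * (b + 1)" if "0 \<le> a" "a \<le> b" for a b :: int
    using that by (intro mult_mono) auto
  moreover have pos: "0 \<le> (t\<^sup>2 - 2) * (r - 1)" using t2_ge r_ge by (intro mult_nonneg_nonneg) auto
  moreover have "(t\<^sup>2 - 2) * (r - 1) \<le> (n - (t\<^sup>2 - 2)) * (r - 1)"
    using m_tau_ge pos by linarith
  ultimately have "((t\<^sup>2 - 2) * (r - 1)) * ((t\<^sup>2 - 2) * (r - 1) + 1)
      \<le> ((n - (t\<^sup>2 - 2)) * (r - 1)) * ((n - (t\<^sup>2 - 2)) * (r - 1) + 1)"
    by blast
  with rn_le_m_theta show ?thesis by (rule order_trans)
qed

lemma cond_h: "drackn_cond_h n r c"
proof -
  have *: "real_of_int (r * n) \<le> 1 / 2 * of_int m * (of_int m + 1)"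
    if "2 * (r * n) \<le> m * (m + 1)" for m
  proof -
    have "real_of_int (2 * (r * n)) \<le> of_int (m * (m + 1))"
      using that unfolding of_int_le_iff .
    then show ?thesis by simp
  qed
  have "r \<noteq> 2" using r_ge by simp
  then show ?thesis
    unfolding drackn_cond_h_def m_theta_eq m_tau_eq
    using *[OF rn_le_m_theta] *[OF rn_le_m_tau] by blast
qed

section \<open>Condition (i)\<close>

lemma m_theta_small_iff: "n > (t\<^sup>2 - 2) * (r - 1) - r + 3 \<longleftrightarrow> 2 * r \<le> t\<^sup>2 + 1"
proof -
  have "a > b \<longleftrightarrow> x > 2" if "2 * (a - b) = x - 2" for a b x :: int
    using that by auto
  \<comment> \<open>This factorization yields the threshold: as
    \<open>t\<^sup>2 - 3 \<ge> 6\<close>, the product exceeds 2 exactly when the other factor is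
    positive.\<close>
  moreover have "2 * (n - ((t\<^sup>2 - 2) * (r - 1) - r + 3)) = (t\<^sup>2 - 3) * (t\<^sup>2 + 2 - 2 * r) - 2"
    using n_eq by (simp add: algebra_simps)
  ultimately have "n > (t\<^sup>2 - 2) * (r - 1) - r + 3 \<longleftrightarrow> (t\<^sup>2 - 3) * (t\<^sup>2 + 2 - 2 * r) > 2"
    by blast
  also have "\<dots> \<longleftrightarrow> t\<^sup>2 + 2 - 2 * r \<ge> 1"
  proof
    assume "t\<^sup>2 + 2 - 2 * r \<ge> 1"
    then have "(t\<^sup>2 - 3) * 1 \<le> (t\<^sup>2 - 3) * (t\<^sup>2 + 2 - 2 * r)"
      using t2_ge by (intro mult_left_mono) auto
    moreover have "2 < (t\<^sup>2 - 3) * 1" using t2_ge by simp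
    ultimately show "(t\<^sup>2 - 3) * (t\<^sup>2 + 2 - 2 * r) > 2" by (rule less_le_trans[rotated])
  next
    assume "(t\<^sup>2 - 3) * (t\<^sup>2 + 2 - 2 * r) > 2"
    then have "0 < (t\<^sup>2 - 3) * (t\<^sup>2 + 2 - 2 * r)" by linarith
    then have "0 < t\<^sup>2 + 2 - 2 * r" using t2_ge by (simp add: zero_less_mult_iff)
    then show "t\<^sup>2 + 2 - 2 * r \<ge> 1" by simp
  qed
  finally show ?thesis by linarith
qed

lemma m_tau_large: "n \<le> (n - (t\<^sup>2 - 2)) * (r - 1) - r + 3"
proof -
  \<comment> \<open>With \<open>m = n - (t\<^sup>2 - 2)\<close>, the right-hand side of the goal is
    \<open>(m - 1) * (r - 1) + 2\<close>.\<close>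
  have "(n - (t\<^sup>2 - 2) - 1) * 3 \<le> (n - (t\<^sup>2 - 2) - 1) * (r - 1)"
    using r_ge t2_ge n_ge by (intro mult_left_mono) auto
  then show ?thesis
    using n_ge t2_ge by (simp add: algebra_simps)
qed

text \<open>By \<open>rc_eq_mult\<close>, the quotients \<open>c / (h + 1)\<close> and
  \<open>(t - 1) / r\<close> coincide.\<close>

lemma theta_dvd_iff: "h + 1 dvd c \<longleftrightarrow> r dvd t - 1"
proof
  assume "h + 1 dvd c"
  then obtain k where "c = (h + 1) * k" by (elim dvdE)
  with rc_eq_mult have "(h + 1) * (r * k) = (h + 1) * (t - 1)" by (simp add: algebra_simps)
  moreover have "h + 1 \<noteq> 0" using h_ge t_pos by linarith
  ultimately have "t - 1 = r * k" by (metis mult_cancel_left)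
  then show "r dvd t - 1" by simp
next
  assume "r dvd t - 1"
  then obtain k where "t - 1 = r * k" by (elim dvdE)
  with rc_eq_mult have "r * c = r * ((h + 1) * k)" by (simp add: algebra_simps)
  then have "c = (h + 1) * k" using r_ge by simp
  then show "h + 1 dvd c" by simp
qed

lemma cond_i_iff: "drackn_cond_i n r c \<longleftrightarrow> (2 * r \<le> t\<^sup>2 + 1 \<longrightarrow> r dvd t - 1)"
proof -
  have *: "real_of_int n > of_int m - of_int r + 3 \<longleftrightarrow> n > m - r + 3" for m
    by linarith
  have "r > 2" using r_ge by simp
  then have "drackn_cond_i n r c \<longleftrightarrow>
      (n > (t\<^sup>2 - 2) * (r - 1) - r + 3 \<longrightarrow> h + 1 dvd c) \<and>
      (\<forall>b. real_of_int b = - of_int t \<and> n > (n - (t\<^sup>2 - 2)) * (r - 1) - r + 3 \<longrightarrow> b + 1 dvd c)"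
    unfolding drackn_cond_i_def theta_eq tau_eq m_theta_eq m_tau_eq * of_int_eq_iff by auto
  then show ?thesis
    using m_theta_small_iff m_tau_large theta_dvd_iff by auto
qed

text \<open>One direction holds because \<open>t - 1\<close> is a factor of \<open>2 * n\<close>.
  For the other, \<open>p\<close> divides \<open>(t - 1) ^ 3 * (t + 2)\<close>, and the factor
  \<open>t + 2\<close> is the delicate case.\<close>

lemma odd_prime_dvd_iff:
  fixes p :: int
  assumes "prime p" and "odd p" and "p dvd r"
  shows "p dvd n \<longleftrightarrow> p dvd t - 1"
proof
  assume "p dvd t - 1"
  moreover have "2 * n = (t - 1) * ((t\<^sup>2 - 2) * (t + 1))"
    unfolding n_eq by (simp add: algebra_simps power2_eq_square)
  ultimately have "p dvd 2 * n" by simp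
  moreover have "coprime p 2" using \<open>odd p\<close> by simp
  ultimately show "p dvd n" by (simp add: coprime_dvd_mult_right_iff)
next
  assume n: "p dvd n"
  have "p dvd 2 * (r * c)" using \<open>p dvd r\<close> by simp
  then have "p dvd (t - 1) ^ 3 \<or> p dvd t + 2"
    unfolding rc_eq using \<open>prime p\<close> by (simp add: prime_dvd_mult_iff)
  then show "p dvd t - 1"
  proof
    assume "p dvd (t - 1) ^ 3"
    then show ?thesis using \<open>prime p\<close> by (rule prime_dvd_power[rotated])
  next
    assume t: "p dvd t + 2"
    \<comment> \<open>Since \<open>t\<close> is congruent to \<open>-2\<close>, the prime \<open>p\<close> divides \<open>6\<close>; and \<open>-2\<close> is \<open>1\<close> modulo \<open>3\<close>.\<close>
    have "2 * (n - 3) = (t + 2) * ((t - 2) * (t\<^sup>2 + 1))"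
      using n_eq by (simp add: algebra_simps power2_eq_square)
    then have "p dvd 2 * (n - 3)" using t by simp
    moreover have "coprime p 2" using \<open>odd p\<close> by simp
    ultimately have "p dvd n - 3" using coprime_dvd_mult_right_iff by blast
    with n have "p dvd n - (n - 3)" by (rule dvd_diff)
    moreover have "n - (n - 3) = 3" by simp
    ultimately have "p dvd 3" by (simp only:)
    then have "p dvd t + 2 - 3" using t by (intro dvd_diff)
    then show ?thesis by simp
  qed
qed

lemma feasible_iff:
  "abelian_drackn_feasible n r c \<longleftrightarrow>
     c \<ge> 2 \<and> (2 * r \<le> t\<^sup>2 + 1 \<longrightarrow> r dvd t - 1) \<and> (odd t \<longrightarrow> even c) \<and>
     (\<forall>p :: int. prime p \<and> odd p \<and> p dvd r \<longrightarrow> p dvd t - 1)"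
proof -
  have "n \<ge> 2" using cond_a c_pos r_ge unfolding drackn_cond_a_def by linarith
  moreover have "drackn_cond_j n r c \<longleftrightarrow>
      (\<forall>p :: int. prime p \<and> odd p \<and> p dvd r \<longrightarrow> p dvd t - 1)"
    unfolding drackn_cond_j_def using odd_prime_dvd_iff by blast
  ultimately show ?thesis
    unfolding abelian_drackn_feasible_def cond_e_iff cond_f_iff cond_i_iff
    using cond_a cond_b cond_c cond_d cond_g cond_h r_ge c_pos by auto
qed

end

theorem theorem6p8:
  fixes t n r c :: int
  assumes "t > 0" and "n > 0" and "r > 0" and "c > 0"
    and "real_of_int n = 1 / 2 * ((real_of_int t)\<^sup>2 - 2) * ((real_of_int t)\<^sup>2 - 1)"
    and "real_of_int (r * c) = 1 / 2 * (real_of_int t - 1) ^ 3 * (real_of_int t + 2)"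
    and "r \<ge> 4" and "even r"
  shows "abelian_drackn_feasible n r c \<longleftrightarrow>
     (t \<ge> 3 \<and> \<not> 4 dvd t) \<and>
     c \<ge> 2 \<and>
     (real_of_int r \<le> 1 / 2 * ((real_of_int t)\<^sup>2 + 1) \<longrightarrow> r dvd t - 1) \<and>
     (odd t \<longrightarrow> even c) \<and>
     (\<forall>p :: int. prime p \<and> odd p \<and> p dvd r \<longrightarrow> p dvd t - 1)"
proof -
  have "real_of_int (2 * n) = of_int ((t\<^sup>2 - 2) * (t\<^sup>2 - 1))"
    using assms(5) by simp
  then have n: "2 * n = (t\<^sup>2 - 2) * (t\<^sup>2 - 1)" unfolding of_int_eq_iff .
  have "real_of_int (2 * (r * c)) = of_int ((t - 1) ^ 3 * (t + 2))"
    using assms(6) by simp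
  then have rc: "2 * (r * c) = (t - 1) ^ 3 * (t + 2)" unfolding of_int_eq_iff .
  \<comment> \<open>The factors have opposite parity, so theta is an integer.\<close>
  have "even (t * (t\<^sup>2 - 3))" by simp
  then obtain h where h: "t * (t\<^sup>2 - 3) = 2 * h" by (elim dvdE)
  interpret drackn_family t n r c h
    using assms n rc h by unfold_locales auto
  have "real_of_int r \<le> 1 / 2 * ((real_of_int t)\<^sup>2 + 1) \<longleftrightarrow>
      real_of_int (2 * r) \<le> of_int (t\<^sup>2 + 1)"
    by (simp add: mult.commute)
  also have "\<dots> \<longleftrightarrow> 2 * r \<le> t\<^sup>2 + 1" by (rule of_int_le_iff)
  finally show ?thesis
    using feasible_iff t_ge not_4_dvd_t by blast
qed

end
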